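(* Let $\varphi^{p}_{[m],l}$, $1\le m\le M$, $0\le l\le 2^{m}-1$, be the complementary wavelet packets associated with the discrete-time-spline wavelet packets $\psi^{p}_{[m],l}$ of order $p$. Then: (i) For all $m=1,\dots,M$, $l=0,\dots,2^m-1$ and all $n$, $\left|\hat{\varphi}^{p}_{[m],l}[n]\right|=\left|\hat{\psi}^{p}_{[m],l}[n]\right|$. (ii) For any $m=1,\dots,M$ and any $l=1,\dots,2^{m}-2$, the signal $\varphi^{p}_{[m],l}$ is antisymmetric, i.e. there is an integer $K$ such that $\varphi^{p}_{[m],l}[K+k]=-\varphi^{p}_{[m],l}[K-k]$ for all $k\in\mathbb{Z}$. (iii) For any $m=1,\dots,M$, all $l,\lambda\in\{0,\dots,2^m-1\}$ and all $s,t\in\{0,\dots,N/2^m-1\}$, $$\left\langle\varphi^{p}_{[m],l}[\cdot -2^{m}s],\,\varphi^{p}_{[m],\lambda}[\cdot -2^{m}t]\right\rangle=\delta_{l,\lambda}\,\delta_{s,t},$$ where $\delta_{a,b}=1$ if $a=b$ and $0$ otherwise.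
   Context: Let $N=2^{j}$, $\omega=e^{2\pi i/N}$, and let $\Pi[N]$ be the space of real-valued $N$-periodic sequences with inner product $\langle x,y\rangle=\sum_{k=0}^{N-1}x[k]y[k]$. The DFT is $\hat x[n]=\sum_{k=0}^{N-1}\omega^{-kn}x[k]$ ($N$-periodic in $n$). Splines. Let $p\ge 1$ be an integer with $p\le N/2-2$, and $b^{p}(t)=\frac{1}{(p-1)!}\sum_{k=0}^{p}(-1)^{k}\binom{p}{k}\left(t+\frac p2-k\right)_{+}^{p-1}$, $x_+=\max\{x,0\}$ (for $p=1$: $x_+^0$ equals $1$ for $x>0$, $0$ for $x<0$, $1/2$ for $x=0$). Put $$u^{p}[n]=\sum_{k=-N/2}^{N/2-1}\omega^{-kn}b^{p}(k),\qquad v^{p}[n]=\omega^{-n/2}\sum_{k=-N/2}^{N/2-1}\omega^{-kn}b^{p}\left(k+\tfrac12\right)\quad(\omega^{-n/2}=e^{-\pi i n/N}),$$ $$\hat b^{p}_{[1]}[n]=\frac{u^{p}[2n]+v^{p}[2n]}{2},\qquad \Upsilon^{p}[n]=\frac{u^{p}[2n]^2+v^{p}[2n]^2}{4},$$ $$\beta[n]=\frac{\hat b^{p}_{[1]}[n]}{\sqrt{\Upsilon^{p}[n]}},\qquad \alpha[n]=\omega^{n}\beta[n+N/2].$$ Discrete-time-spline wavelet packets (DTSWPs) of order $p$. Let $M\ge1$ be an integer with $2^M<N$. The signals $\psi^{p}_{[m],l}\in\Pi[N]$, $1\le m\le M$, $0\le l\le 2^m-1$, are defined by their DFTs: $\hat\psi^{p}_{[1],0}[n]=\beta[n]$,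 $\hat\psi^{p}_{[1],1}[n]=\alpha[n]$, and, for $\lambda=0,\dots,2^m-1$, $\mu=0,1$, $\hat\psi^{p}_{[m+1],\rho}[n]=\hat\psi^{p}_{[m],\lambda}[n]\,\hat\psi^{p}_{[1],\mu}[2^m n]$, where $\rho=2\lambda+\mu$ if $\lambda$ is even and $\rho=2\lambda+1-\mu$ if $\lambda$ is odd. Complementary wavelet packets (cWPs). The signals $\varphi^{p}_{[m],l}\in\Pi[N]$ are defined by their DFTs: $\hat\varphi^{p}_{[m],l}[n]=-i\,\hat\psi^{p}_{[m],l}[n]$ if $0<n<N/2$; $\hat\varphi^{p}_{[m],l}[n]=i\,\hat\psi^{p}_{[m],l}[n]$ if $-N/2<n<0$; $\hat\varphi^{p}_{[m],l}[n]=\hat\psi^{p}_{[m],l}[n]$ if $n=0$ or $n=N/2$. *)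

theory Defs
  imports Complex_Main
begin

definition periodic_signals :: "nat \<Rightarrow> (int \<Rightarrow> real) set" where
  "periodic_signals N = {x. \<forall>k. x (k + int N) = x k}"

definition signal_inner :: "nat \<Rightarrow> (int \<Rightarrow> real) \<Rightarrow> (int \<Rightarrow> real) \<Rightarrow> real" where
  "signal_inner N x y = (\<Sum>k = 0..int N - 1. x k * y k)"

definition omega :: "nat \<Rightarrow> complex" where
  "omega N = exp (2 * of_real pi * \<i> / of_nat N)"

definition dft :: "nat \<Rightarrow> (int \<Rightarrow> real) \<Rightarrow> int \<Rightarrow> complex" where
  "dft N x n = (\<Sum>k = 0..int N - 1. omega N powi (- k * n) * of_real (x k))"

text \<open>The truncated power, where the exponent 0 takes the value 1/2 at the jump. This is not
  \<open>max x 0 ^ 0\<close>, which is 1 everywhere in HOL.\<close>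

definition trunc_power :: "nat \<Rightarrow> real \<Rightarrow> real" where
  "trunc_power q x =
     (if q = 0 then (if x > 0 then 1 else if x < 0 then 0 else 1/2) else (max x 0) ^ q)"

definition bspline :: "nat \<Rightarrow> real \<Rightarrow> real" where
  "bspline p t =
     1 / fact (p - 1) *
     (\<Sum>k = 0..p. (- 1) ^ k * real (p choose k) * trunc_power (p - 1) (t + real p / 2 - real k))"

definition u_seq :: "nat \<Rightarrow> nat \<Rightarrow> int \<Rightarrow> complex" where
  "u_seq N p n =
     (\<Sum>k = - (int N div 2)..int N div 2 - 1.
        omega N powi (- k * n) * of_real (bspline p (of_int k)))"

definition v_seq :: "nat \<Rightarrow> nat \<Rightarrow> int \<Rightarrow> complex" where
  "v_seq N p n =
     exp (- (of_real pi * \<i> * of_int n / of_nat N)) *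
     (\<Sum>k = - (int N div 2)..int N div 2 - 1.
        omega N powi (- k * n) * of_real (bspline p (of_int k + 1/2)))"

definition bhat1 :: "nat \<Rightarrow> nat \<Rightarrow> int \<Rightarrow> complex" where
  "bhat1 N p n = (u_seq N p (2 * n) + v_seq N p (2 * n)) / 2"

definition Upsilon :: "nat \<Rightarrow> nat \<Rightarrow> int \<Rightarrow> complex" where
  "Upsilon N p n = ((u_seq N p (2 * n))\<^sup>2 + (v_seq N p (2 * n))\<^sup>2) / 4"

text \<open>By the symmetry of the spline, \<open>u_seq\<close> and \<open>v_seq\<close> take real values, so \<open>csqrt\<close> is here the
  nonnegative square root of a nonnegative real number.\<close>

definition beta :: "nat \<Rightarrow> nat \<Rightarrow> int \<Rightarrow> complex" where
  "beta N p n = bhat1 N p n / csqrt (Upsilon N p n)"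

definition alpha :: "nat \<Rightarrow> nat \<Rightarrow> int \<Rightarrow> complex" where
  "alpha N p n = omega N powi n * beta N p (n + int N div 2)"

text \<open>In the recursion, the pair of \<open>a\<close> and \<open>\<mu>\<close> is recovered from \<open>\<rho>\<close>; see \<open>dtswp_hat_step\<close>. The
  level 0 is a dummy.\<close>

fun dtswp_hat :: "nat \<Rightarrow> nat \<Rightarrow> nat \<Rightarrow> nat \<Rightarrow> int \<Rightarrow> complex" where
  "dtswp_hat N p 0 l n = 0"
| "dtswp_hat N p (Suc 0) l n = (if l = 0 then beta N p n else alpha N p n)"
| "dtswp_hat N p (Suc (Suc m)) \<rho> n =
     (let a = \<rho> div 2; \<mu> = (if even a then \<rho> mod 2 else 1 - \<rho> mod 2)
      in dtswp_hat N p (Suc m) a n * dtswp_hat N p (Suc 0) \<mu> (2 ^ Suc m * n))"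

lemma dtswp_hat_step:
  assumes "m \<ge> 1" "\<mu> \<in> {0, 1}"
    and "\<rho> = (if even a then 2 * a + \<mu> else 2 * a + 1 - \<mu>)"
  shows "dtswp_hat N p (m + 1) \<rho> n = dtswp_hat N p m a n * dtswp_hat N p 1 \<mu> (2 ^ m * n)"
proof -
  obtain m' where m: "m = Suc m'"
    using assms(1) by (cases m) auto
  have "\<rho> div 2 = a" and "(if even a then \<rho> mod 2 else 1 - \<rho> mod 2) = \<mu>"
    using assms(2,3) by (auto split: if_splits)
  then show ?thesis
    unfolding m by (simp add: Let_def)
qed

text \<open>The signals are the elements of \<open>periodic_signals N\<close> determined by their DFT.\<close>

definition dtswp :: "nat \<Rightarrow> nat \<Rightarrow> nat \<Rightarrow> nat \<Rightarrow> int \<Rightarrow> real" where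
  "dtswp N p m l = (THE x. x \<in> periodic_signals N \<and> (\<forall>n. dft N x n = dtswp_hat N p m l n))"

definition cwp :: "nat \<Rightarrow> nat \<Rightarrow> nat \<Rightarrow> nat \<Rightarrow> int \<Rightarrow> real" where
  "cwp N p m l =
     (THE x. x \<in> periodic_signals N \<and>
        (\<forall>n. (0 < n \<and> 2 * n < int N \<longrightarrow> dft N x n = - \<i> * dft N (dtswp N p m l) n) \<and>
             (- int N < 2 * n \<and> n < 0 \<longrightarrow> dft N x n = \<i> * dft N (dtswp N p m l) n) \<and>
             (n = 0 \<or> 2 * n = int N \<longrightarrow> dft N x n = dft N (dtswp N p m l) n)))"

definition antisymmetric_signal :: "(int \<Rightarrow> real) \<Rightarrow> bool" where
  "antisymmetric_signal x \<longleftrightarrow> (\<exists>K. \<forall>k. x (K + k) = - x (K - k))"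

end

theory Submission
  imports Defs "HOL-Computational_Algebra.Polynomial"
begin

text \<open>Write \<open>H x = (\<Sum>r. bspline p (r/2) * cos (r x))\<close> for the cosine sum of the samples of the spline at
  the multiples of \<open>1/2\<close>. The even \<open>r\<close> contribute \<open>u (2 n)\<close> and the odd \<open>r\<close> contribute \<open>v (2 n)\<close>, so at
  \<open>x = 2 \<pi> n / N\<close> their sum is \<open>H x\<close> and the difference \<open>u (2 n) - v (2 n)\<close> is \<open>H (x + \<pi>)\<close>. Hence \<open>beta\<close> is
  \<open>\<surd>2 * H x / sqrt ((H x)\<^sup>2 + (H (x + \<pi>))\<^sup>2)\<close>: a real, even, \<open>N\<close>-periodic sequence with
  \<open>(beta n)\<^sup>2 + (beta (n + N/2))\<^sup>2 = 2\<close>, provided the denominator never vanishes.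

  That \<open>H x\<close> and \<open>H (x + \<pi>)\<close> have no common zero is the one analytic fact
  (\<open>spline_symbol_no_common_zero\<close>). The recursion of B-splines in the order translates into
  \<open>p * H\<^sub>p\<^sub>+\<^sub>1 = p * cos x * H\<^sub>p - sin x * H\<^sub>p'\<close>, which says that the quotient of \<open>H\<^sub>p\<close> by \<open>sin\<^sup>p\<close> is,
  up to a negative constant, differentiated in each step. For \<open>p = 1\<close> this quotient is \<open>cot (x/2)\<close>, and
  differentiating a polynomial in a cotangent multiplies its derivative by \<open>1 + cot\<^sup>2\<close> (and by a
  negative constant), so for every \<open>p\<close> it is a polynomial in \<open>cot (x/2)\<close> with nonnegative coefficients,
  positive on \<open>(0, \<pi>)\<close>. Therefore \<open>H\<close> vanishes only at odd multiples of \<open>\<pi>\<close>.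

  Everything else is the algebra of an orthogonal filter bank. The quadrature identity makes the
  \<open>2 \<times> 2\<close> matrix formed by \<open>beta\<close>, \<open>alpha\<close> and their shifts by \<open>N/2\<close> a multiple of a unitary one, and
  the product structure of the packets turns this, by induction on the level, into
  \<open>dtswp_hat_orthogonal\<close>. Passing to the complementary packets multiplies all transforms by the same
  unimodular sequence \<open>rotation\<close>. Thus absolute values do not change, and neither do the products
  of one transform with the conjugate of another, so Parseval's identity gives the orthonormality.

  Finally, each packet transform is a linear phase \<open>\<omega>\<^bsup>C n\<^esup>\<close> times a real even sequence. The
  sequence \<open>rotation\<close> is odd except at frequencies \<open>0\<close> and \<open>N/2\<close>; the low-pass filter vanishes at
  \<open>N/2\<close> and the high-pass filter at \<open>0\<close>, which kills both exceptional frequencies for all packets but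
  the first and the last. For the others, \<open>rotation\<close> makes the real factor odd, and the
  signal is antisymmetric about \<open>- C\<close>.\<close>

section \<open>Centred B-splines\<close>

lemma times_trunc_power: "x * trunc_power q x = trunc_power (Suc q) x"
  by (auto simp: trunc_power_def max_def)

text \<open>The Cox-de Boor recursion. With \<open>y = t + (q + 2)/2\<close>, both sides are combinations of the powers
  \<open>trunc_power q (y - k)\<close>; on the right their coefficients combine through Pascal's rule and
  absorption to \<open>y - k\<close> times a binomial coefficient, and that factor raises the exponent.
  The value \<open>1/2\<close> at the jump does no harm, because there the factor \<open>y - k\<close> is \<open>0\<close>.\<close>

lemma bspline_Suc:
  "real (Suc q) * bspline (Suc (Suc q)) t =
     (t + (real q + 2) / 2) * bspline (Suc q) (t + 1/2)
     + ((real q + 2) / 2 - t) * bspline (Suc q) (t - 1/2)"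
proof -
  define y where "y k = t + (real q + 2) / 2 - real k" for k
  define g where "g k = (-1) ^ k * real (Suc q choose k) * trunc_power q (y k)" for k
  define h where "h k = (-1) ^ k * real (Suc q choose k) * trunc_power q (y (Suc k))" for k
  define f where "f k = (-1) ^ k * real (Suc (Suc q) choose k) * trunc_power (Suc q) (y k)" for k
  have f0: "f 0 = y 0 * g 0"
    by (simp add: f_def g_def times_trunc_power)
  have fS: "f (Suc k) = y 0 * g (Suc k) + (real q + 2 - y 0) * h k" for k
  proof -
    have "Suc k * (Suc (Suc q) choose Suc k) = Suc (Suc q) * (Suc q choose k)"
      by (rule Suc_times_binomial)
    from arg_cong[OF this, of real]
    have a: "(real k + 1) * real (Suc (Suc q) choose Suc k) = (real q + 2) * real (Suc q choose k)"
      by (simp add: algebra_simps del: binomial_Suc_Suc)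
    have b: "real (Suc (Suc q) choose Suc k) = real (Suc q choose k) + real (Suc q choose Suc k)"
      by simp
    have c: "y (Suc k) * real (Suc (Suc q) choose Suc k)
        = y 0 * real (Suc q choose Suc k) - (real q + 2 - y 0) * real (Suc q choose k)"
    proof -
      have "y (Suc k) * real (Suc (Suc q) choose Suc k)
        = y 0 * real (Suc (Suc q) choose Suc k) - (real k + 1) * real (Suc (Suc q) choose Suc k)"
        by (simp add: y_def algebra_simps del: binomial_Suc_Suc)
      then show ?thesis unfolding a unfolding b by (simp add: algebra_simps del: binomial_Suc_Suc)
    qed
    have "f (Suc k) = (-1) ^ Suc k * (y (Suc k) * real (Suc (Suc q) choose Suc k)) * trunc_power q (y (Suc k))"
      by (simp add: f_def flip: times_trunc_power del: binomial_Suc_Suc)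
    then show ?thesis unfolding c
      by (simp add: g_def h_def algebra_simps del: binomial_Suc_Suc)
  qed
  have "(\<Sum>k=0..Suc (Suc q). f k) = f 0 + (\<Sum>k=0..Suc q. f (Suc k))"
    by (simp only: sum.atLeast0_atMost_Suc_shift o_def)
  also have "\<dots> = y 0 * (g 0 + (\<Sum>k=0..Suc q. g (Suc k))) + (real q + 2 - y 0) * (\<Sum>k=0..Suc q. h k)"
    unfolding f0 fS sum.distrib sum_distrib_left[symmetric] by (simp add: distrib_left del: sum.cl_ivl_Suc)
  also have "g 0 + (\<Sum>k=0..Suc q. g (Suc k)) = (\<Sum>k=0..Suc (Suc q). g k)"
    by (simp only: sum.atLeast0_atMost_Suc_shift o_def)
  also have "\<dots> = (\<Sum>k=0..Suc q. g k)"
    by (simp add: g_def binomial_eq_0 del: binomial_Suc_Suc)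
  finally have *: "(\<Sum>k=0..Suc (Suc q). f k)
      = y 0 * (\<Sum>k=0..Suc q. g k) + (real q + 2 - y 0) * (\<Sum>k=0..Suc q. h k)" .
  have L: "real (Suc q) * bspline (Suc (Suc q)) t = (\<Sum>k=0..Suc (Suc q). f k) / fact q"
  proof -
    have "bspline (Suc (Suc q)) t = (\<Sum>k=0..Suc (Suc q). f k) / (real (Suc q) * fact q)"
      unfolding bspline_def f_def y_def diff_Suc_1 fact_Suc of_nat_mult
      by (simp add: add_ac del: sum.cl_ivl_Suc binomial_Suc_Suc)
    then show ?thesis by simp
  qed
  have arg1: "t + 1/2 + real (Suc q) / 2 - real k = y k" for k
    by (simp add: y_def field_simps)
  have R1: "bspline (Suc q) (t + 1/2) = (\<Sum>k=0..Suc q. g k) / fact q"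
    unfolding bspline_def g_def arg1 by simp
  have arg2: "t - 1/2 + real (Suc q) / 2 - real k = y (Suc k)" for k
    by (simp add: y_def field_simps)
  have R2: "bspline (Suc q) (t - 1/2) = (\<Sum>k=0..Suc q. h k) / fact q"
    unfolding bspline_def h_def arg2 by simp
  have y0: "real q + 2 - y 0 = (real q + 2) / 2 - t" "y 0 = t + (real q + 2) / 2"
    by (simp_all add: y_def field_simps)
  show ?thesis unfolding L * R1 R2 y0(1) y0(2)
    by (simp add: add_divide_distrib del: sum.cl_ivl_Suc)
qed

lemma bspline_1: "bspline (Suc 0) t = trunc_power 0 (t + 1/2) - trunc_power 0 (t - 1/2)"
  by (simp add: bspline_def)

text \<open>The two summands of the recursion are exchanged by \<open>t \<mapsto> - t\<close>. For order 1 the symmetry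
  holds also at the jumps, where it rests on the value \<open>1/2\<close>.\<close>

lemma bspline_minus: "bspline (Suc q) (- t) = bspline (Suc q) t"
proof (induction q arbitrary: t)
  case 0
  show ?case by (auto simp: bspline_1 trunc_power_def)
next
  case (Suc q)
  have "real (Suc q) * bspline (Suc (Suc q)) (- t) = real (Suc q) * bspline (Suc (Suc q)) t"
    unfolding bspline_Suc
    using Suc.IH[of "t - 1/2"] Suc.IH[of "t + 1/2"] by (simp add: algebra_simps)
  then show ?case by simp
qed

lemma bspline_eq_0:
  assumes "\<bar>t\<bar> > real (Suc q) / 2"
  shows "bspline (Suc q) t = 0"
proof -
  have *: "bspline (Suc q) t = 0" if "t < - (real (Suc q) / 2)" for t
  proof -
    have "t + real (Suc q) / 2 - real k < 0" for k
      using that by linarith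
    moreover have "trunc_power q x = 0" if "x < 0" for x
      using that by (simp add: trunc_power_def)
    ultimately have "trunc_power q (t + real (Suc q) / 2 - real k) = 0" for k
      by blast
    then show ?thesis
      by (simp add: bspline_def del: sum.cl_ivl_Suc)
  qed
  show ?thesis
    using *[of t] *[of "- t"] assms bspline_minus[of q t] by linarith
qed

section \<open>The symbol of the half-integer samples\<close>

text \<open>The samples outside the range of summation vanish by \<open>bspline_eq_0\<close>. The end points
  \<open>r = \<plusminus> p\<close> lie in it because of the order 1, whose samples there are \<open>1/2\<close>.\<close>

definition spline_symbol :: "nat \<Rightarrow> real \<Rightarrow> real" where
  "spline_symbol p x = (\<Sum>r = - int p..int p. bspline p (of_int r / 2) * cos (of_int r * x))"

text \<open>\<open>cos (r x)\<close> is a Chebyshev polynomial in \<open>cos x\<close>. This handles the periodicity and the symmetry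
  of the symbol in one stroke.\<close>

lemma cos_int_mult_cong:
  fixes x y :: real
  assumes "cos x = cos y"
  shows "cos (of_int r * x) = cos (of_int r * y)"
proof -
  have cheb: "cos (real (Suc (Suc n)) * z) = 2 * cos z * cos (real (Suc n) * z) - cos (real n * z)"
    for n z
  proof -
    have "cos ((real n + 1) * z + z) + cos ((real n + 1) * z - z) = 2 * cos z * cos ((real n + 1) * z)"
      unfolding cos_add cos_diff by simp
    then show ?thesis by (simp add: algebra_simps)
  qed
  have nat: "cos (real n * x) = cos (real n * y)" for n
    by (induction n rule: induct_nat_012) (use assms in \<open>simp, simp, simp only: cheb\<close>)
  show ?thesis
    using nat by (cases r rule: int_cases2) simp_all
qed

lemma spline_symbol_cong_cos:
  "cos x = cos y \<Longrightarrow> spline_symbol p x = spline_symbol p y"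
  unfolding spline_symbol_def
  by (intro sum.cong refl arg_cong2[where f = "(*)"] cos_int_mult_cong)

lemma spline_symbol_1: "spline_symbol (Suc 0) x = 1 + cos x"
proof -
  have "{-1..1::int} = {-1,0,1}" by auto
  then show ?thesis
    by (simp add: spline_symbol_def bspline_1 trunc_power_def)
qed

lemma DERIV_spline_symbol:
  "(spline_symbol p has_field_derivative
      - (\<Sum>r = - int p..int p. bspline p (of_int r / 2) * (of_int r * sin (of_int r * x)))) (at x)"
  unfolding spline_symbol_def sum_negf[symmetric]
  by (rule DERIV_sum) (auto intro!: derivative_eq_intros)

text \<open>The B-spline recursion in the frequency domain: shifting the samples by one step turns into a
  factor \<open>cos x\<close> or \<open>sin x\<close>, and multiplying the samples by \<open>r\<close> into a derivative.\<close>

lemma spline_symbol_Suc: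
  fixes x D :: real
  assumes "(spline_symbol (Suc q) has_field_derivative D) (at x)"
  shows "real (Suc q) * spline_symbol (Suc (Suc q)) x
      = real (Suc q) * cos x * spline_symbol (Suc q) x - sin x * D"
proof -
  define c where "c r = bspline (Suc q) (of_int r / 2)" for r :: int
  define P where "P = int (Suc q)"
  have c0: "c r = 0" if "r < - P \<or> r > P" for r
  proof -
    have "\<bar>r\<bar> > P" using that by (auto simp: P_def)
    then have "\<bar>real_of_int r\<bar> > real_of_int P" by linarith
    then show ?thesis unfolding c_def by (intro bspline_eq_0) (auto simp: P_def)
  qed
  have D: "D = - (\<Sum>r = - P..P. c r * (of_int r * sin (of_int r * x)))"
    using DERIV_unique[OF assms DERIV_spline_symbol] by (simp add: c_def P_def)
  have rec: "real (Suc q) * bspline (Suc (Suc q)) (of_int r / 2)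
      = (r + P + 1) / 2 * c (r + 1) + (P + 1 - r) / 2 * c (r - 1)" for r :: int
    unfolding bspline_Suc c_def by (simp add: P_def field_simps)
  have "real (Suc q) * spline_symbol (Suc (Suc q)) x
      = (\<Sum>r = - (P + 1)..P + 1. real (Suc q) * bspline (Suc (Suc q)) (of_int r / 2) * cos (of_int r * x))"
    unfolding spline_symbol_def sum_distrib_left P_def by (simp add: mult_ac add.commute)
  also have "\<dots> = (\<Sum>r = - (P + 1)..P + 1. (r + P + 1) / 2 * c (r + 1) * cos (of_int r * x))
      + (\<Sum>r = - (P + 1)..P + 1. (P + 1 - r) / 2 * c (r - 1) * cos (of_int r * x))"
    unfolding rec sum.distrib[symmetric] by (simp add: distrib_right)
  also have "(\<Sum>r = - (P + 1)..P + 1. (r + P + 1) / 2 * c (r + 1) * cos (of_int r * x))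
      = (\<Sum>s = - P..P + 2. (s + P) / 2 * c s * cos ((of_int s - 1) * x))"
    by (rule sum.reindex_bij_witness[of _ "\<lambda>s. s - 1" "\<lambda>r. r + 1"]) auto
  also have "\<dots> = (\<Sum>s = - P..P. (s + P) / 2 * c s * cos ((of_int s - 1) * x))"
    by (rule sum.mono_neutral_right) (auto simp: c0)
  also have "(\<Sum>r = - (P + 1)..P + 1. (P + 1 - r) / 2 * c (r - 1) * cos (of_int r * x))
      = (\<Sum>s = - P - 2..P. (P - s) / 2 * c s * cos ((of_int s + 1) * x))"
    by (rule sum.reindex_bij_witness[of _ "\<lambda>s. s + 1" "\<lambda>r. r - 1"]) auto
  also have "\<dots> = (\<Sum>s = - P..P. (P - s) / 2 * c s * cos ((of_int s + 1) * x))"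
    by (rule sum.mono_neutral_right) (auto simp: c0)
  also have "(\<Sum>s = - P..P. (s + P) / 2 * c s * cos ((of_int s - 1) * x))
        + (\<Sum>s = - P..P. (P - s) / 2 * c s * cos ((of_int s + 1) * x))
      = (\<Sum>s = - P..P. P * cos x * (c s * cos (of_int s * x)) + sin x * (c s * (of_int s * sin (of_int s * x))))"
    unfolding sum.distrib[symmetric]
  proof (rule sum.cong[OF refl])
    fix s :: int
    have e1: "cos ((of_int s - 1) * x) = cos (of_int s * x) * cos x + sin (of_int s * x) * sin x"
     and e2:      "cos ((of_int s + 1) * x) = cos (of_int s * x) * cos x - sin (of_int s * x) * sin x"
      by (simp_all add: algebra_simps cos_add cos_diff)
    show "(s + P) / 2 * c s * cos ((of_int s - 1) * x) + (P - s) / 2 * c s * cos ((of_int s + 1) * x)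
        = P * cos x * (c s * cos (of_int s * x)) + sin x * (c s * (of_int s * sin (of_int s * x)))"
      unfolding e1 e2 by (simp add: field_simps)
  qed
  also have "\<dots> = real (Suc q) * cos x * spline_symbol (Suc q) x - sin x * D"
    unfolding D sum.distrib sum_distrib_left[symmetric]
    by (simp add: spline_symbol_def c_def P_def)
  finally show ?thesis .
qed

lemma spline_symbol_0: "spline_symbol (Suc q) 0 = 2"
proof (induction q)
  case (Suc q)
  from spline_symbol_Suc[OF DERIV_spline_symbol, of q 0] Suc show ?case
    by (simp del: of_nat_Suc)
qed (simp add: spline_symbol_1)

text \<open>The polynomial \<open>Q\<close> for which the symbol of order \<open>q + 1\<close> is \<open>sin x ^ (q + 1) * Q (cot (x/2))\<close>; the
  order is shifted by one. The factor \<open>1 + X\<^sup>2\<close> comes from the derivative of the cotangent.\<close>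

fun cot_poly :: "nat \<Rightarrow> real poly" where
  "cot_poly 0 = [:0, 1:]"
| "cot_poly (Suc q) = smult (1 / (2 * real (Suc q))) ([:1, 0, 1:] * pderiv (cot_poly q))"

text \<open>The recursion preserves nonnegativity of the coefficients, and it differentiates a
  polynomial of degree \<open>q + 1\<close> and multiplies by one of degree 2, so the polynomial never dies out.\<close>

lemma poly_cot_poly_pos:
  assumes "c > 0"
  shows "poly (cot_poly q) c > 0"
proof -
  have "(\<forall>i. coeff (cot_poly q) i \<ge> 0) \<and> degree (cot_poly q) = Suc q"
  proof (induction q)
    case 0
    show ?case by (auto simp: coeff_pCons split: nat.splits)
  next
    case (Suc q)
    have "pderiv (cot_poly q) \<noteq> 0"
      using Suc by (simp add: pderiv_eq_0_iff)
    then have "degree (cot_poly (Suc q)) = Suc (Suc q)"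
      using Suc by (simp add: degree_mult_eq degree_pderiv del: mult_pCons_left)
    moreover have "coeff (cot_poly (Suc q)) i \<ge> 0" for i
      using Suc by (auto simp: coeff_pderiv coeff_pCons split: nat.splits)
    ultimately show ?case by blast
  qed
  then have nn: "\<And>i. coeff (cot_poly q) i \<ge> 0" and deg: "degree (cot_poly q) = Suc q"
    by auto
  have "lead_coeff (cot_poly q) \<noteq> 0"
    using deg by (subst leading_coeff_0_iff) auto
  then have "coeff (cot_poly q) (Suc q) > 0"
    using nn[of "Suc q"] deg by simp
  then have "0 < coeff (cot_poly q) (Suc q) * c ^ Suc q"
    using assms by simp
  also have "\<dots> \<le> (\<Sum>i\<le>Suc q. coeff (cot_poly q) i * c ^ i)"
    using nn assms by (intro member_le_sum) auto
  also have "\<dots> = poly (cot_poly q) c"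
    by (simp add: poly_altdef deg)
  finally show ?thesis .
qed

text \<open>Substituting \<open>sin x ^ (q + 1) * Q (cot (x/2))\<close> into \<open>spline_symbol_Suc\<close>, the derivative of the
  power of the sine cancels the term with \<open>cos x\<close>, and only the derivative of \<open>Q\<close> survives.\<close>

lemma spline_symbol_cot:
  assumes "0 < x" "x < pi"
  shows "spline_symbol (Suc q) x = sin x ^ Suc q * poly (cot_poly q) (cot (x / 2))"
  using assms
proof (induction q arbitrary: x)
  case 0
  have "sin (x / 2) > 0" using 0 by (intro sin_gt_zero) auto
  moreover have "sin x = 2 * sin (x / 2) * cos (x / 2)" using sin_double[of "x / 2"] by simp
  moreover have "cos x = 2 * (cos (x / 2))\<^sup>2 - 1" using cos_double_cos[of "x / 2"] by simp
  ultimately show ?case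
    by (simp add: spline_symbol_1 cot_def power2_eq_square)
next
  case (Suc q)
  have sp: "sin (x / 2) > 0" using Suc.prems by (intro sin_gt_zero) auto
  define c where "c = cot (x / 2)"
  have cs: "inverse ((sin (x / 2))\<^sup>2) = 1 + c\<^sup>2"
    proof -
    have "1 + c\<^sup>2 = ((sin (x / 2))\<^sup>2 + (cos (x / 2))\<^sup>2) / (sin (x / 2))\<^sup>2"
      using sp unfolding c_def cot_def power_divide add_divide_distrib by simp
    then show ?thesis by (simp add: inverse_eq_divide)
  qed
  have "((\<lambda>x. cot (x / 2)) has_field_derivative - (1 + c\<^sup>2) * (1 / 2)) (at x)"
    unfolding cs[symmetric] using sp
    by (intro DERIV_chain2[OF DERIV_cot]) (auto intro!: derivative_eq_intros)
  from DERIV_mult[OF DERIV_power_Suc[OF DERIV_sin] DERIV_chain2[OF poly_DERIV this]]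
  have "((\<lambda>x. sin x ^ Suc q * poly (cot_poly q) (cot (x / 2))) has_field_derivative
      real (Suc q) * sin x ^ q * cos x * poly (cot_poly q) c
      + sin x ^ Suc q * (poly (pderiv (cot_poly q)) c * (- ((1 + c\<^sup>2) / 2)))) (at x)"
    by (rule DERIV_cong) (simp add: c_def add_divide_distrib diff_divide_distrib algebra_simps)
  then have "(spline_symbol (Suc q) has_field_derivative
      real (Suc q) * sin x ^ q * cos x * poly (cot_poly q) c
      + sin x ^ Suc q * (poly (pderiv (cot_poly q)) c * (- ((1 + c\<^sup>2) / 2)))) (at x)"
    by (rule has_field_derivative_transform_within_open[where S = "{0<..<pi}"])
       (use Suc in \<open>auto\<close>)
  from spline_symbol_Suc[OF this]
  have "real (Suc q) * spline_symbol (Suc (Suc q)) x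
      = sin x ^ Suc (Suc q) * ((1 + c\<^sup>2) * poly (pderiv (cot_poly q)) c / 2)"
    unfolding Suc.IH[OF Suc.prems] c_def[symmetric] by (simp add: algebra_simps del: of_nat_Suc)
  also have "(1 + c\<^sup>2) * poly (pderiv (cot_poly q)) c / 2
      = real (Suc q) * poly (cot_poly (Suc q)) c"
    by (simp add: power2_eq_square algebra_simps del: of_nat_Suc)
  finally have "real (Suc q) * spline_symbol (Suc (Suc q)) x
      = real (Suc q) * (sin x ^ Suc (Suc q) * poly (cot_poly (Suc q)) c)"
    by (simp only: mult_ac)
  moreover have "real (Suc q) \<noteq> 0" by simp
  ultimately show ?case
    unfolding c_def using mult_left_cancel by blast
qed

lemma spline_symbol_pos:
  assumes "0 < x" "x < pi"
  shows "spline_symbol (Suc q) x > 0"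
proof -
  have "sin (x / 2) > 0" "cos (x / 2) > 0"
    using assms by (auto intro!: sin_gt_zero cos_gt_zero)
  then have "cot (x / 2) > 0" by (simp add: cot_def)
  then show ?thesis
    unfolding spline_symbol_cot[OF assms] using assms
    by (intro mult_pos_pos poly_cot_poly_pos zero_less_power sin_gt_zero)
qed

text \<open>By symmetry and periodicity \<open>x\<close> may be moved into \<open>[0, \<pi>]\<close>. There the symbol is positive except at
  \<open>\<pi>\<close>, and in that case \<open>x + \<pi>\<close> is equivalent to \<open>0\<close>.\<close>

lemma spline_symbol_no_common_zero:
  "spline_symbol (Suc q) x \<noteq> 0 \<or> spline_symbol (Suc q) (x + pi) \<noteq> 0"
proof -
  define y where "y = arccos (cos x)"
  have y: "0 \<le> y" "y \<le> pi" "cos y = cos x"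
    by (auto simp: y_def arccos_lbound arccos_ubound cos_arccos)
  then have Hy: "spline_symbol (Suc q) x = spline_symbol (Suc q) y"
    by (intro spline_symbol_cong_cos) simp
  consider "y = 0" | "0 < y" "y < pi" | "y = pi" using y by linarith
  then show ?thesis
  proof cases
    case 1
    then show ?thesis using Hy by (simp add: spline_symbol_0)
  next
    case 2
    then show ?thesis using Hy spline_symbol_pos[of y q] by simp
  next
    case 3
    then have "cos (x + pi) = cos 0" using y by simp
    from spline_symbol_cong_cos[OF this] show ?thesis by (simp add: spline_symbol_0)
  qed
qed

section \<open>Periodic sequences on the integers\<close>

lemma periodic_add_mult:
  fixes g :: "int \<Rightarrow> 'a"
  assumes "\<And>k. g (k + N) = g k"
  shows "g (k + N * q) = g k"
proof (induction q rule: int_induct[of _ 0])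
  case (step1 i)
  then show ?case using assms[of "k + N * i"] by (simp add: algebra_simps)
next
  case (step2 i)
  then show ?case using assms[of "k + N * (i - 1)"] by (simp add: algebra_simps)
qed simp

lemma periodic_cong_mod:
  fixes g :: "int \<Rightarrow> 'a"
  assumes "\<And>k. g (k + N) = g k" and "a mod N = b mod N"
  shows "g a = g b"
proof -
  have "g k = g (k mod N)" for k
    using periodic_add_mult[of g N "k mod N" "k div N"] assms(1) by simp
  then show ?thesis using assms(2) by metis
qed

lemma sum_shift_periodic:
  fixes g :: "int \<Rightarrow> 'a::comm_monoid_add"
  assumes "N > 0" and per: "\<And>k. g (k + N) = g k"
  shows "(\<Sum>k = 0..N - 1. g (k + a)) = (\<Sum>k = 0..N - 1. g k)"
proof (rule sum.reindex_bij_witness[of _ "\<lambda>k. (k - a) mod N" "\<lambda>k. (k + a) mod N"])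
  fix k assume "k \<in> {0..N - 1}"
  then show "((k + a) mod N - a) mod N = k" "((k - a) mod N + a) mod N = k"
    by (simp_all add: mod_simps)
  show "g ((k + a) mod N) = g (k + a)"
    by (rule periodic_cong_mod[of g N, OF per]) simp
qed (use assms(1) in auto)

lemma sum_reflect_periodic:
  fixes g :: "int \<Rightarrow> 'a::comm_monoid_add"
  assumes "N > 0" and per: "\<And>k. g (k + N) = g k"
  shows "(\<Sum>k = 0..N - 1. g (- k)) = (\<Sum>k = 0..N - 1. g k)"
proof (rule sum.reindex_bij_witness[of _ "\<lambda>k. (- k) mod N" "\<lambda>k. (- k) mod N"])
  fix k assume "k \<in> {0..N - 1}"
  then show "(- ((- k) mod N)) mod N = k" "(- ((- k) mod N)) mod N = k"
    by (simp_all add: mod_simps)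
  show "g ((- k) mod N) = g (- k)"
    by (rule periodic_cong_mod[of g N, OF per]) simp
qed (use assms(1) in auto)

section \<open>Roots of unity and the discrete Fourier transform\<close>

lemma omega_powi: "omega N powi a = cis (2 * pi * of_int a / of_nat N)"
proof -
  have "omega N = cis (2 * pi / of_nat N)"
    by (simp add: omega_def cis_conv_exp mult_ac)
  then show ?thesis by (simp add: cis_power_int mult_ac)
qed

lemma omega_powi_add: "omega N powi (a + b) = omega N powi a * omega N powi b"
  by (simp add: omega_powi cis_mult add_divide_distrib distrib_left)

lemma omega_nonzero [simp]: "omega N \<noteq> 0"
  by (simp add: omega_def)

lemma cnj_omega_powi [simp]: "cnj (omega N) powi a = omega N powi (- a)"
  by (simp add: omega_powi cis_cnj flip: complex_cnj_power_int)

lemma omega_powi_eq_1_iff: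
  assumes "N > 0"
  shows "omega N powi a = 1 \<longleftrightarrow> int N dvd a"
proof
  assume "omega N powi a = 1"
  then have "cos (2 * pi * of_int a / of_nat N) = 1"
    by (simp add: omega_powi complex_eq_iff)
  then obtain n :: int where "2 * pi * of_int a / of_nat N = of_int n * 2 * pi"
    unfolding cos_one_2pi_int by blast
  then have "real_of_int a = real_of_int (int N * n)"
    using assms by (simp add: field_simps)
  then have "a = int N * n" by (simp only: of_int_eq_iff)
  then show "int N dvd a" by simp
next
  assume "int N dvd a"
  then obtain n where "a = int N * n" ..
  then show "omega N powi a = 1" using assms cis_multiple_2pi[of "of_int n"]
    by (simp add: omega_powi mult_ac)
qed

lemma omega_powi_cong:
  assumes "N > 0" "int N dvd a - b"
  shows "omega N powi a = omega N powi b"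
proof -
  have "omega N powi a = omega N powi (a - b) * omega N powi b"
    by (simp flip: omega_powi_add)
  then show ?thesis using omega_powi_eq_1_iff[of N "a - b"] assms by simp
qed

lemma sum_omega_powi:
  assumes "N > 0"
  shows "(\<Sum>k = 0..int N - 1. omega N powi (k * a)) = (if int N dvd a then of_nat N else 0)"
proof (cases "int N dvd a")
  case True
  then have "omega N powi (k * a) = 1" for k
    using omega_powi_eq_1_iff[OF assms] by simp
  then show ?thesis using True by simp
next
  case False
  let ?S = "\<Sum>k = 0..int N - 1. omega N powi (k * a)"
  have "?S = (\<Sum>k = 0..int N - 1. omega N powi ((k + 1) * a))"
    by (rule sum_shift_periodic[symmetric])
       (use assms in \<open>auto intro!: omega_powi_cong simp: algebra_simps\<close>)
  also have "\<dots> = omega N powi a * ?S"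
    unfolding distrib_right omega_powi_add sum_distrib_left by (simp add: mult.commute)
  finally have "(1 - omega N powi a) * ?S = 0" by (simp add: algebra_simps)
  then show ?thesis using False omega_powi_eq_1_iff[OF assms] by auto
qed

text \<open>The discrete analogue of integrating against a Dirac kernel; both directions of Fourier
  inversion reduce to it.\<close>

lemma sum_omega_kernel:
  fixes f :: "int \<Rightarrow> complex"
  assumes "N > 0" and per: "\<And>k. f (k + int N) = f k"
  shows "(\<Sum>l = 0..int N - 1. f l * (\<Sum>n = 0..int N - 1. omega N powi (n * (k - l)))) = of_nat N * f k"
proof -
  have "int N dvd k - l \<longleftrightarrow> l = k mod int N" if "l \<in> {0..int N - 1}" for l
    using that mod_eq_dvd_iff[of k "int N" l] by auto
  then have "(\<Sum>l = 0..int N - 1. f l * (\<Sum>n = 0..int N - 1. omega N powi (n * (k - l))))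
      = (\<Sum>l = 0..int N - 1. if l = k mod int N then of_nat N * f l else 0)"
    by (intro sum.cong refl) (simp add: sum_omega_powi[OF assms(1)])
  also have "\<dots> = of_nat N * f (k mod int N)"
    using assms(1) by (simp add: sum.delta)
  also have "f (k mod int N) = f k"
    by (rule periodic_cong_mod[of f "int N", OF per]) simp
  finally show ?thesis .
qed

lemma dft_inverse:
  assumes "N > 0" "x \<in> periodic_signals N"
  shows "of_nat N * of_real (x k) = (\<Sum>n = 0..int N - 1. omega N powi (k * n) * dft N x n)"
proof -
  have "(\<Sum>n = 0..int N - 1. omega N powi (k * n) * dft N x n)
      = (\<Sum>n = 0..int N - 1. \<Sum>l = 0..int N - 1. of_real (x l) * omega N powi (n * (k - l)))"
    unfolding dft_def sum_distrib_left
    by (intro sum.cong refl) (simp add: algebra_simps flip: omega_powi_add)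
  also have "\<dots> = (\<Sum>l = 0..int N - 1. of_real (x l) * (\<Sum>n = 0..int N - 1. omega N powi (n * (k - l))))"
    unfolding sum_distrib_left by (rule sum.swap)
  also have "\<dots> = of_nat N * of_real (x k)"
    using assms by (intro sum_omega_kernel) (auto simp: periodic_signals_def)
  finally show ?thesis by simp
qed

lemma dft_periodic:
  assumes "N > 0"
  shows "dft N x (n + int N) = dft N x n"
  unfolding dft_def
  by (intro sum.cong refl arg_cong2[where f = "(*)"] omega_powi_cong assms) (simp add: algebra_simps)

lemma dft_inj:
  assumes "N > 0" "x \<in> periodic_signals N" "y \<in> periodic_signals N" "\<And>n. dft N x n = dft N y n"
  shows "x = y"
proof
  fix k
  have "of_nat N * complex_of_real (x k) = of_nat N * complex_of_real (y k)"
    unfolding dft_inverse[OF assms(1,2)] dft_inverse[OF assms(1,3)] assms(4) ..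
  then show "x k = y k" using assms(1) by simp
qed

text \<open>Conjugate symmetry is exactly what makes the inverse transform real. Together with \<open>dft_inj\<close> this
  justifies defining a real signal by its transform.\<close>

lemma dft_surj:
  assumes "N > 0" and per: "\<And>n. X (n + int N) = X n" and sym: "\<And>n. cnj (X n) = X (- n)"
  obtains x where "x \<in> periodic_signals N" "\<And>n. dft N x n = X n"
proof
  define z where "z k = (\<Sum>n = 0..int N - 1. omega N powi (k * n) * X n) / of_nat N" for k
  have "cnj (z k) = z k" for k
  proof -
    have "cnj (z k) = (\<Sum>n = 0..int N - 1. omega N powi (k * (- n)) * X (- n)) / of_nat N"
      by (simp add: z_def sym)
    also have "(\<Sum>n = 0..int N - 1. omega N powi (k * (- n)) * X (- n))
        = (\<Sum>n = 0..int N - 1. omega N powi (k * n) * X n)"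
      by (rule sum_reflect_periodic[where g = "\<lambda>n. omega N powi (k * n) * X n"])
         (use assms(1) in \<open>auto simp: per algebra_simps intro!: omega_powi_cong\<close>)
    finally show ?thesis by (simp add: z_def)
  qed
  then have re: "of_real (Re (z k)) = z k" for k
    by (metis Reals_cnj_iff of_real_Re)
  have "z (k + int N) = z k" for k
    unfolding z_def
    by (intro arg_cong2[where f = "(/)"] sum.cong refl arg_cong2[where f = "(*)"] omega_powi_cong assms(1))
       (simp add: algebra_simps)
  then show "(\<lambda>k. Re (z k)) \<in> periodic_signals N" by (simp add: periodic_signals_def)
  fix n
  have "of_nat N * dft N (\<lambda>k. Re (z k)) n
      = (\<Sum>k = 0..int N - 1. \<Sum>l = 0..int N - 1. X l * omega N powi (k * (l - n)))"
    unfolding dft_def re sum_distrib_left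
  proof (rule sum.cong[OF refl])
    fix k
    have "of_nat N * (omega N powi (- k * n) * z k)
        = omega N powi (- k * n) * (\<Sum>l = 0..int N - 1. omega N powi (k * l) * X l)"
      using assms(1) by (simp add: z_def)
    also have "\<dots> = (\<Sum>l = 0..int N - 1. X l * omega N powi (k * (l - n)))"
      unfolding sum_distrib_left
    proof (rule sum.cong[OF refl])
      fix l
      have "k * (l - n) = - k * n + k * l" by (simp add: algebra_simps)
      then show "omega N powi (- k * n) * (omega N powi (k * l) * X l) = X l * omega N powi (k * (l - n))"
        by (simp only: omega_powi_add mult_ac)
    qed
    finally show "of_nat N * (omega N powi (- k * n) * z k) = (\<Sum>l = 0..int N - 1. X l * omega N powi (k * (l - n)))" .
  qed
  also have "\<dots> = (\<Sum>l = 0..int N - 1. X l * (\<Sum>k = 0..int N - 1. omega N powi (k * (l - n))))"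
    unfolding sum_distrib_left by (rule sum.swap)
  also have "\<dots> = (\<Sum>l = 0..int N - 1. X l * (\<Sum>k = 0..int N - 1. omega N powi (k * (n - l))))"
  proof -
    have "int N dvd a \<longleftrightarrow> int N dvd b" if "a = - b" for a b using that by simp
    from this[of "l - n" "n - l" for l] show ?thesis
      by (simp add: sum_omega_powi[OF assms(1)])
  qed
  also have "\<dots> = of_nat N * X n"
    using assms(1) per by (rule sum_omega_kernel)
  finally show "dft N (\<lambda>k. Re (z k)) n = X n" using assms(1) by simp
qed

lemma dft_shift:
  assumes "N > 0" "x \<in> periodic_signals N"
  shows "dft N (\<lambda>k. x (k - a)) n = omega N powi (- a * n) * dft N x n"
proof -
  define g where "g k = omega N powi (- k * n) * complex_of_real (x (k - a))" for k
  have x: "x (k + int N) = x k" for k using assms(2) by (simp add: periodic_signals_def)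
  have "g (k + int N) = g k" for k
    unfolding g_def
  proof (intro arg_cong2[where f = "(*)"])
    show "omega N powi (- (k + int N) * n) = omega N powi (- k * n)"
      by (intro omega_powi_cong assms(1)) (simp add: algebra_simps)
    show "complex_of_real (x (k + int N - a)) = complex_of_real (x (k - a))"
      using x[of "k - a"] by (simp add: algebra_simps)
  qed
  then have "(\<Sum>k = 0..int N - 1. g (k + a)) = dft N (\<lambda>k. x (k - a)) n"
    using assms(1) unfolding dft_def by (subst sum_shift_periodic) (auto simp: g_def)
  moreover have "g (k + a) = omega N powi (- a * n) * (omega N powi (- k * n) * of_real (x k))" for k
    by (simp add: g_def algebra_simps flip: omega_powi_add)
  ultimately show ?thesis
    by (simp add: dft_def sum_distrib_left)
qed

lemma parseval:
  assumes "N > 0" "y \<in> periodic_signals N"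
  shows "of_nat N * complex_of_real (signal_inner N x y)
      = (\<Sum>n = 0..int N - 1. dft N x n * cnj (dft N y n))"
proof -
  have y: "of_nat N * complex_of_real (y k) = (\<Sum>n = 0..int N - 1. omega N powi (- k * n) * cnj (dft N y n))" for k
    using arg_cong[OF dft_inverse[OF assms, of k], of cnj] by simp
  have "of_nat N * complex_of_real (signal_inner N x y)
      = (\<Sum>k = 0..int N - 1. of_real (x k) * (of_nat N * of_real (y k)))"
    by (simp add: signal_inner_def sum_distrib_left mult_ac)
  also have "\<dots> = (\<Sum>k = 0..int N - 1. \<Sum>n = 0..int N - 1.
      (omega N powi (- k * n) * of_real (x k)) * cnj (dft N y n))"
    unfolding y sum_distrib_left by (simp add: mult_ac)
  also have "\<dots> = (\<Sum>n = 0..int N - 1. \<Sum>k = 0..int N - 1.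
      (omega N powi (- k * n) * of_real (x k)) * cnj (dft N y n))"
    by (rule sum.swap)
  also have "\<dots> = (\<Sum>n = 0..int N - 1. dft N x n * cnj (dft N y n))"
    by (simp add: dft_def sum_distrib_right)
  finally show ?thesis .
qed

section \<open>The low-pass and high-pass filters\<close>

lemma sum_even_odd:
  fixes g :: "int \<Rightarrow> 'a::comm_monoid_add"
  shows "(\<Sum>k = - int h..int h - 1. g (2 * k) + g (2 * k + 1)) = (\<Sum>r = - int (2 * h)..int (2 * h) - 1. g r)"
proof (induction h)
  case (Suc h)
  have 1: "{- int (Suc h)..int (Suc h) - 1} = insert (- int h - 1) (insert (int h) {- int h..int h - 1})"
    by auto
  have 2: "{- int (2 * Suc h)..int (2 * Suc h) - 1} = insert (2 * (- int h - 1)) (insert (2 * (- int h - 1) + 1)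
     (insert (2 * int h) (insert (2 * int h + 1) {- int (2 * h)..int (2 * h) - 1})))"
    by auto
  show ?case unfolding 1 2 using Suc.IH by (simp add: add_ac)
qed simp

lemma spline_symbol_pi: "spline_symbol (Suc q) pi = 0"
proof (induction q)
  case (Suc q)
  from spline_symbol_Suc[OF DERIV_spline_symbol, of q pi] Suc show ?case
    by (simp del: of_nat_Suc)
qed (simp add: spline_symbol_1)

text \<open>The sine parts cancel by symmetry of the spline, and the longer summation range adds only zeros.\<close>

lemma spline_symbol_eq_cis_sum:
  assumes "0 < p" "p < 2 * h"
  shows "complex_of_real (spline_symbol p y)
    = (\<Sum>r = - int (2 * h)..int (2 * h) - 1. cis (- (of_int r * y)) * of_real (bspline p (of_int r / 2)))"
proof -
  obtain q where p: "p = Suc q" using assms(1) by (cases p) auto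
  have "(\<Sum>r = - int (2 * h)..int (2 * h) - 1. cis (- (of_int r * y)) * of_real (bspline p (of_int r / 2)))
     = (\<Sum>r = - int p..int p. cis (- (of_int r * y)) * of_real (bspline p (of_int r / 2)))"
  proof (rule sum.mono_neutral_right)
    show "\<forall>r \<in> {- int (2 * h)..int (2 * h) - 1} - {- int p..int p}.
        cis (- (of_int r * y)) * of_real (bspline p (of_int r / 2)) = 0"
    proof
      fix r assume "r \<in> {- int (2 * h)..int (2 * h) - 1} - {- int p..int p}"
      then have "\<bar>r\<bar> > int p" by auto
      then have "\<bar>real_of_int r\<bar> > real p" by linarith
      then show "cis (- (of_int r * y)) * of_real (bspline p (of_int r / 2)) = 0"
        using bspline_eq_0[of q "of_int r / 2"] by (simp add: p)
    qed
  qed (use assms in auto)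
  also have "\<dots> = of_real (spline_symbol p y)"
  proof -
    let ?S = "\<Sum>r = - int p..int p. sin (of_int r * y) * bspline p (of_int r / 2)"
    have "?S = (\<Sum>r = - int p..int p. - (sin (of_int r * y) * bspline p (of_int r / 2)))"
      by (rule sum.reindex_bij_witness[of _ uminus uminus])
         (use bspline_minus[of q "of_int r / 2" for r] p in auto)
    then have "?S = 0" by (simp add: sum_negf)
    then show ?thesis
      by (simp add: complex_eq_iff spline_symbol_def mult.commute sum_negf)
  qed
  finally show ?thesis ..
qed

lemma sum_int_interval_eq_sum_nat: "(\<Sum>k = 0..int n - 1. g k) = (\<Sum>k<n. g (int k))"
  by (rule sum.reindex_bij_witness[of _ int nat]) auto

text \<open>The weak bound \<open>p < N\<close> already ensures that the window of length \<open>N\<close> in \<open>u_seq\<close> and \<open>v_seq\<close>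
  sees all nonzero samples.\<close>

locale spline_filters =
  fixes N p :: nat
  assumes N: "even N" "0 < N" and p: "0 < p" "p < N"
begin

abbreviation node :: "int \<Rightarrow> real" where
  "node n \<equiv> 2 * pi * of_int n / of_nat N"

text \<open>The arguments of \<open>u_seq\<close> and \<open>v_seq\<close> are doubled, so that integer samples acquire the even and
  half-integer samples the odd multiples of the angle \<open>2 \<pi> n / N\<close>. Adding \<open>\<pi>\<close> to the angle then flips
  exactly the sign of the half-integer samples.\<close>

lemma u_seq_add_v_seq: "u_seq N p (2 * n) + v_seq N p (2 * n) = of_real (spline_symbol p (node n))" (is ?A)
  and u_seq_diff_v_seq: "u_seq N p (2 * n) - v_seq N p (2 * n) = of_real (spline_symbol p (node n + pi))" (is ?B)
proof -
  obtain h where h: "N = 2 * h" using N by auto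
  let ?b = "\<lambda>r::int. complex_of_real (bspline p (of_int r / 2))"
  have u: "u_seq N p (2 * n) = (\<Sum>k = - int h..int h - 1. cis (- (of_int (2 * k) * node n)) * ?b (2 * k))"
    unfolding u_seq_def omega_powi
    by (intro sum.cong) (auto simp: h field_simps)
  have v: "v_seq N p (2 * n) = (\<Sum>k = - int h..int h - 1. cis (- (of_int (2 * k + 1) * node n)) * ?b (2 * k + 1))"
  proof -
    have e: "exp (- (of_real pi * \<i> * of_int (2 * n) / of_nat N)) = cis (- node n)"
      by (simp add: cis_conv_exp mult_ac)
    have angle: "- node n + 2 * pi * of_int (- k * 2 * n) / of_nat N = - (of_int (2 * k + 1) * node n)" for k
      by (simp add: algebra_simps add_divide_distrib)
    have half: "of_int k + 1 / 2 = (of_int (2 * k + 1) / 2 :: real)" for k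
      by simp
    have "int N div 2 = int h" by (simp add: h)
    then show ?thesis
      unfolding v_seq_def omega_powi half e sum_distrib_left mult.assoc[symmetric] cis_mult angle by simp
  qed
  have ph: "p < 2 * h" using p h by simp
  show ?A
    unfolding u v sum.distrib[symmetric] spline_symbol_eq_cis_sum[OF p(1) ph]
    by (rule sum_even_odd)
  have *: "cis (- (of_int r * (y + pi))) = (if even r then 1 else - 1) * cis (- (of_int r * y))" for r y
  proof -
    have "cis (- (of_int r * (y + pi))) = cis (- (pi * of_int r)) * cis (- (of_int r * y))"
      by (simp add: cis_mult algebra_simps)
    also have "cis (- (pi * of_int r)) = (if even r then 1 else - 1)"
      by (simp add: complex_eq_iff)
    finally show ?thesis .
  qed
  show ?B
    unfolding u v sum_subtractf[symmetric] spline_symbol_eq_cis_sum[OF p(1) ph] sum_even_odd[symmetric] *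
    by simp
qed

definition lowpass :: "int \<Rightarrow> real" where
  "lowpass n = spline_symbol p (node n) / 2 /
     sqrt (((spline_symbol p (node n))\<^sup>2 + (spline_symbol p (node n + pi))\<^sup>2) / 8)"

text \<open>Uses \<open>u\<^sup>2 + v\<^sup>2 = ((u + v)\<^sup>2 + (u - v)\<^sup>2) / 2\<close>. The radicand is a nonnegative real, so the complex
  square root is the real one.\<close>

lemma beta_eq_lowpass: "beta N p n = of_real (lowpass n)"
proof -
  have "Upsilon N p n = ((u_seq N p (2 * n) + v_seq N p (2 * n))\<^sup>2 + (u_seq N p (2 * n) - v_seq N p (2 * n))\<^sup>2) / 8"
    by (simp add: Upsilon_def power2_eq_square field_simps)
  then have "Upsilon N p n = of_real (((spline_symbol p (node n))\<^sup>2 + (spline_symbol p (node n + pi))\<^sup>2) / 8)"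
    by (simp add: u_seq_add_v_seq u_seq_diff_v_seq)
  then have "csqrt (Upsilon N p n)
      = of_real (sqrt (((spline_symbol p (node n))\<^sup>2 + (spline_symbol p (node n + pi))\<^sup>2) / 8))"
    by (simp only: csqrt_of_real[OF divide_nonneg_nonneg] sum_power2_ge_zero zero_le_numeral)
  then show ?thesis
    by (simp add: beta_def bhat1_def u_seq_add_v_seq lowpass_def)
qed

lemma spline_symbol_2pi: "spline_symbol p (x + 2 * pi) = spline_symbol p x"
  by (rule spline_symbol_cong_cos) simp

lemma node_half: "node (n + int N div 2) = node n + pi"
proof -
  have "real_of_int (int N div 2) = real N / 2" using N by (auto elim!: evenE)
  then show ?thesis using N by (simp add: field_simps)
qed

lemma lowpass_periodic: "lowpass (n + int N) = lowpass n"
proof -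
  have "node (n + int N) = node n + 2 * pi" using N by (simp add: field_simps)
  then show ?thesis using spline_symbol_2pi[of "node n"] spline_symbol_2pi[of "node n + pi"]
    by (simp add: lowpass_def add_ac)
qed

lemma lowpass_even: "lowpass (- n) = lowpass n"
proof -
  have "spline_symbol p (node (- n)) = spline_symbol p (node n)"
    "spline_symbol p (node (- n) + pi) = spline_symbol p (node n + pi)"
    by (auto intro: spline_symbol_cong_cos)
  then show ?thesis by (simp add: lowpass_def)
qed

text \<open>Passing from \<open>n\<close> to \<open>n + N/2\<close> exchanges \<open>H x\<close> and \<open>H (x + \<pi>)\<close> and leaves the denominator unchanged.\<close>

lemma lowpass_quadrature: "(lowpass n)\<^sup>2 + (lowpass (n + int N div 2))\<^sup>2 = 2"
proof -
  define a where "a = spline_symbol p (node n)"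
  define b where "b = spline_symbol p (node n + pi)"
  have "a \<noteq> 0 \<or> b \<noteq> 0"
    using spline_symbol_no_common_zero[of "p - 1" "node n"] p by (simp add: a_def b_def)
  then have pos: "a\<^sup>2 + b\<^sup>2 > 0" by (simp add: sum_power2_gt_zero_iff)
  have "spline_symbol p (node n + pi + pi) = a"
    using spline_symbol_2pi[of "node n"] by (simp add: a_def add_ac)
  then have "(lowpass n)\<^sup>2 + (lowpass (n + int N div 2))\<^sup>2
      = (a / 2 / sqrt ((a\<^sup>2 + b\<^sup>2) / 8))\<^sup>2 + (b / 2 / sqrt ((b\<^sup>2 + a\<^sup>2) / 8))\<^sup>2"
    unfolding lowpass_def node_half by (simp add: a_def b_def)
  also have "\<dots> = 2"
  proof -
    define d where "d = a\<^sup>2 + b\<^sup>2"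
    have d: "d > 0" "b\<^sup>2 + a\<^sup>2 = d" using pos by (simp_all add: d_def)
    then have "(a / 2 / sqrt (d / 8))\<^sup>2 + (b / 2 / sqrt (d / 8))\<^sup>2 = (a\<^sup>2 + b\<^sup>2) * 2 / d"
      by (simp add: power_divide add_divide_distrib)
    then show ?thesis using d unfolding d(2) d_def[symmetric] by simp
  qed
  finally show ?thesis .
qed

lemma node_int_half: "node (int N div 2) = pi"
  using node_half[of 0] by (simp only: add_0)

lemma lowpass_half: "lowpass (int N div 2) = 0"
  unfolding lowpass_def node_int_half using spline_symbol_pi[of "p - 1"] p by simp

text \<open>The packets of level 1 are the filters themselves: low-pass for index 0, high-pass for all others.\<close>

abbreviation filt :: "nat \<Rightarrow> int \<Rightarrow> complex" where
  "filt \<equiv> dtswp_hat N p (Suc 0)"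

lemma alpha_eq_lowpass: "alpha N p n = omega N powi n * of_real (lowpass (n + int N div 2))"
  by (simp add: alpha_def beta_eq_lowpass)

lemma two_half: "int N div 2 + int N div 2 = int N"
  using N(1) by presburger

lemma omega_half: "omega N powi (n + int N div 2) = - (omega N powi n)"
proof -
  have "omega N powi (int N div 2) = - 1"
    unfolding omega_powi node_int_half by simp
  then show ?thesis unfolding omega_powi_add by simp
qed

lemma filt_periodic: "filt \<mu> (n + int N) = filt \<mu> n"
proof -
  have "omega N powi (n + int N) = omega N powi n"
    by (rule omega_powi_cong) (use N in auto)
  then show ?thesis
    using lowpass_periodic[of "n + int N div 2"]
    by (simp add: beta_eq_lowpass alpha_eq_lowpass lowpass_periodic add_ac)
qed

text \<open>The filter bank is orthogonal. The diagonal cases are the quadrature identity. Off the diagonal the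
  two products cancel, because the modulation in \<open>alpha\<close> changes sign under the shift by \<open>N/2\<close>.\<close>

lemma filt_orthogonal:
  assumes "\<mu> < 2" "\<nu> < 2"
  shows "filt \<mu> n * cnj (filt \<nu> n) + filt \<mu> (n + int N div 2) * cnj (filt \<nu> (n + int N div 2))
    = (if \<mu> = \<nu> then 2 else 0)"
proof -
  define a where "a = complex_of_real (lowpass n)"
  define b where "b = complex_of_real (lowpass (n + int N div 2))"
  define w where "w = omega N powi n"
  have w: "w * omega N powi (- n) = 1" by (simp add: w_def flip: omega_powi_add)
  have ab: "a * a + b * b = 2"
    using arg_cong[OF lowpass_quadrature[of n], of complex_of_real]
    by (simp add: a_def b_def power2_eq_square)
  have "lowpass (n + int N div 2 + int N div 2) = lowpass n"
    using lowpass_periodic[of n] two_half by (simp add: add.assoc)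
  then have f: "filt 0 n = a" "filt 0 (n + int N div 2) = b" "filt 1 n = w * b"
      "filt 1 (n + int N div 2) = - w * a"
    by (simp_all add: beta_eq_lowpass alpha_eq_lowpass omega_half a_def b_def w_def)
  have c: "cnj a = a" "cnj b = b" by (simp_all add: a_def b_def)
  have cw: "cnj w = omega N powi (- n)" by (simp add: w_def)
  have "\<mu> = 0 \<or> \<mu> = 1" "\<nu> = 0 \<or> \<nu> = 1" using assms by auto
  then show ?thesis
  proof (elim disjE)
    assume [simp]: "\<mu> = 1" "\<nu> = 1"
    have "w * b * (cnj w * b) + - w * a * (- cnj w * a) = (w * cnj w) * (a * a + b * b)"
      by (simp add: algebra_simps)
    then show ?thesis using ab w by (simp add: f[simplified] c cw)
  qed (use ab in \<open>simp_all add: f[simplified] c\<close>)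
qed

section \<open>Spline wavelet packets\<close>

lemma dtswp_hat_periodic: "dtswp_hat N p m l (n + int N) = dtswp_hat N p m l n"
proof (induction m arbitrary: l rule: induct_nat_012)
  case (ge2 m)
  have "filt \<mu> (2 ^ Suc m * (n + int N)) = filt \<mu> (2 ^ Suc m * n)" for \<mu>
  proof -
    have e: "2 ^ Suc m * (n + int N) = 2 ^ Suc m * n + int N * 2 ^ Suc m" by (simp add: algebra_simps)
    show ?thesis unfolding e by (rule periodic_add_mult) (rule filt_periodic)
  qed
  then show ?case unfolding dtswp_hat.simps(3) Let_def ge2 by simp
qed (use filt_periodic in simp_all)

text \<open>For the high-pass filter, reflection moves \<open>n + N/2\<close> to \<open>n - N/2\<close> (up to sign), which is the
  same frequency modulo \<open>N\<close>.\<close>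

lemma filt_phase:
  "\<exists>C R. (\<forall>n. filt \<mu> n = omega N powi (C * n) * complex_of_real (R n)) \<and> (\<forall>n. R (- n) = R n)"
proof (cases "\<mu> = 0")
  case True
  then show ?thesis
    by (intro exI[of _ 0] exI[of _ lowpass]) (simp add: beta_eq_lowpass lowpass_even)
next
  case False
  have "lowpass (- n + int N div 2) = lowpass (n + int N div 2)" for n
  proof -
    have "lowpass (- n + int N div 2) = lowpass (n - int N div 2)"
      using lowpass_even[of "- n + int N div 2"] by simp
    also have "\<dots> = lowpass (n - int N div 2 + int N)" by (rule lowpass_periodic[symmetric])
    also have "n - int N div 2 + int N = n + int N div 2" using two_half by linarith
    finally show ?thesis .
  qed
  then show ?thesis using False
    by (intro exI[of _ 1] exI[of _ "\<lambda>n. lowpass (n + int N div 2)"]) (simp add: alpha_eq_lowpass)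
qed

text \<open>Linear phase: products and dilations of such sequences are again of this form.\<close>

lemma dtswp_hat_phase:
  "\<exists>C R. (\<forall>n. dtswp_hat N p m l n = omega N powi (C * n) * complex_of_real (R n)) \<and> (\<forall>n. R (- n) = R n)"
proof (induction m arbitrary: l rule: induct_nat_012)
  case 0
  show ?case by (intro exI[of _ 0] exI[of _ "\<lambda>_. 0"]) simp
next
  case 1
  show ?case by (rule filt_phase)
next
  case (ge2 m)
  define \<mu> where "\<mu> = (if even (l div 2) then l mod 2 else 1 - l mod 2)"
  from ge2(2)[of "l div 2"] obtain C R where CR:
    "\<And>n. dtswp_hat N p (Suc m) (l div 2) n = omega N powi (C * n) * complex_of_real (R n)" "\<And>n. R (- n) = R n"
    by blast
  obtain D S where DS: "\<And>n. filt \<mu> n = omega N powi (D * n) * complex_of_real (S n)" "\<And>n. S (- n) = S n"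
    using filt_phase[of \<mu>] by blast
  have "dtswp_hat N p (Suc (Suc m)) l n
     = omega N powi ((C + D * 2 ^ Suc m) * n) * complex_of_real (R n * S (2 ^ Suc m * n))" for n
  proof -
    have e: "(C + D * 2 ^ Suc m) * n = C * n + D * (2 ^ Suc m * n)" by (simp add: algebra_simps)
    show ?thesis
      unfolding dtswp_hat.simps(3) Let_def \<mu>_def[symmetric] CR DS e omega_powi_add of_real_mult
      by (simp only: mult_ac)
  qed
  moreover have "R (- n) * S (2 ^ Suc m * - n) = R n * S (2 ^ Suc m * n)" for n
    using CR(2) DS(2)[of "2 ^ Suc m * n"] by simp
  ultimately show ?case
    by (intro exI[of _ "C + D * 2 ^ Suc m"] exI[of _ "\<lambda>n. R n * S (2 ^ Suc m * n)"]) blast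
qed

lemma cnj_dtswp_hat: "cnj (dtswp_hat N p m l n) = dtswp_hat N p m l (- n)"
proof -
  obtain C R where "\<And>n. dtswp_hat N p m l n = omega N powi (C * n) * complex_of_real (R n)" "\<And>n. R (- n) = R n"
    using dtswp_hat_phase by blast
  then show ?thesis by simp
qed

text \<open>In the Fourier domain, orthonormality of the translates by multiples of \<open>2\<^sup>m\<close> means that the
  correlations, summed over the aliases \<open>n + r N / 2\<^sup>m\<close>, are constant. In the induction step the new
  filter factor depends only on the parity of the alias number \<open>r\<close>, so the sum splits into two
  instances of the hypothesis, weighted by the two terms of \<open>filt_orthogonal\<close>.\<close>

lemma dtswp_hat_orthogonal:
  assumes "N = 2 ^ Suc m * L" "l < 2 ^ Suc m" "l' < 2 ^ Suc m"
  shows "(\<Sum>r<2 ^ Suc m. dtswp_hat N p (Suc m) l (n + int r * int L)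
      * cnj (dtswp_hat N p (Suc m) l' (n + int r * int L))) = (if l = l' then 2 ^ Suc m else 0)"
  using assms
proof (induction m arbitrary: n l l' L)
  case 0
  have "int N div 2 = int L" using 0 by simp
  moreover have "{..<2 ^ Suc 0::nat} = {0, 1}" by auto
  ultimately show ?case using filt_orthogonal[of l l' n] 0 by (simp del: dtswp_hat.simps)
next
  case (Suc m)
  \<comment> \<open>the filter that leads from the packet \<open>\<rho> div 2\<close> to \<open>\<rho>\<close>; the two together determine \<open>\<rho>\<close>\<close>
  define sel :: "nat \<Rightarrow> nat" where "sel \<rho> = (if even (\<rho> div 2) then \<rho> mod 2 else 1 - \<rho> mod 2)" for \<rho>
  have sel2: "sel \<rho> < 2" for \<rho> by (auto simp: sel_def)
  have sel: "\<rho> = \<rho>' \<longleftrightarrow> \<rho> div 2 = \<rho>' div 2 \<and> sel \<rho> = sel \<rho>'" for \<rho> \<rho>'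
  proof (intro iffI conjI)
    assume *: "\<rho> div 2 = \<rho>' div 2 \<and> sel \<rho> = sel \<rho>'"
    have "x mod 2 = 0 \<or> x mod 2 = 1" for x :: nat by auto
    from this[of \<rho>] this[of \<rho>'] * have "\<rho> mod 2 = \<rho>' mod 2"
      by (auto simp: sel_def split: if_splits)
    with * show "\<rho> = \<rho>'" by (metis div_mult_mod_eq)
  qed simp_all
  let ?a = "l div 2" and ?b = "l' div 2"
  define G where "G n = dtswp_hat N p (Suc m) ?a n * cnj (dtswp_hat N p (Suc m) ?b n)" for n
  define F where "F n = filt (sel l) n * cnj (filt (sel l') n)" for n
  have step: "dtswp_hat N p (Suc (Suc m)) l n * cnj (dtswp_hat N p (Suc (Suc m)) l' n)
      = G n * F (2 ^ Suc m * n)" for n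
    unfolding dtswp_hat.simps(3)[of N p m] Let_def G_def F_def sel_def[symmetric] by (simp add: mult_ac)
  have F_per: "F (k + int N * q) = F k" for k q
    unfolding F_def using periodic_add_mult[of "filt \<mu>" "int N" for \<mu>, OF filt_periodic] by simp
  have NL: "int N = 2 ^ Suc m * (2 * int L)" "int N div 2 = 2 ^ Suc m * int L"
    using Suc.prems by simp_all
  have IH: "(\<Sum>r<2 ^ Suc m. G (n + int r * (2 * int L))) = (if ?a = ?b then 2 ^ Suc m else 0)" for n
    using Suc.IH[of "2 * L" ?a ?b n] Suc.prems by (simp add: G_def less_mult_imp_div_less mult_ac)
  have F1: "F (2 ^ Suc m * (n + int (r * 2) * int L)) = F (2 ^ Suc m * n)" for r
    using F_per[of "2 ^ Suc m * n" "int r"] by (simp add: NL algebra_simps)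
  have F2: "F (2 ^ Suc m * (n + int (r * 2 + 1) * int L)) = F (2 ^ Suc m * n + int N div 2)" for r
    using F_per[of "2 ^ Suc m * n + int N div 2" "int r"] unfolding NL by (simp add: algebra_simps)
  have "(\<Sum>r<2 ^ Suc (Suc m). dtswp_hat N p (Suc (Suc m)) l (n + int r * int L)
      * cnj (dtswp_hat N p (Suc (Suc m)) l' (n + int r * int L)))
     = (\<Sum>r<2 ^ Suc m * 2. G (n + int r * int L) * F (2 ^ Suc m * (n + int r * int L)))"
    unfolding step by (simp add: mult.commute)
  also have "\<dots> = (\<Sum>r<2 ^ Suc m. \<Sum>k = r * 2..<r * 2 + 2. G (n + int k * int L) * F (2 ^ Suc m * (n + int k * int L)))"
    by (rule sum.nat_group[symmetric])
  also have "\<dots> = (\<Sum>r<2 ^ Suc m. G (n + int r * (2 * int L)) * F (2 ^ Suc m * n)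
      + G (n + int L + int r * (2 * int L)) * F (2 ^ Suc m * n + int N div 2))"
  proof (rule sum.cong[OF refl])
    fix r :: nat
    have "{r * 2..<r * 2 + 2} = {r * 2, r * 2 + 1}" by auto
    then show "(\<Sum>k = r * 2..<r * 2 + 2. G (n + int k * int L) * F (2 ^ Suc m * (n + int k * int L)))
      = G (n + int r * (2 * int L)) * F (2 ^ Suc m * n)
      + G (n + int L + int r * (2 * int L)) * F (2 ^ Suc m * n + int N div 2)"
      using F1[of r] F2[of r] by (simp add: algebra_simps)
  qed
  also have "\<dots> = (if ?a = ?b then 2 ^ Suc m else 0) * (F (2 ^ Suc m * n) + F (2 ^ Suc m * n + int N div 2))"
    unfolding sum.distrib sum_distrib_right[symmetric] IH by (simp add: distrib_left)
  also have "\<dots> = (if l = l' then 2 ^ Suc (Suc m) else 0)"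
    unfolding F_def filt_orthogonal[OF sel2 sel2] using sel[of l l'] by auto
  finally show ?case .
qed

lemma alpha_0: "alpha N p 0 = 0"
  by (simp add: alpha_eq_lowpass lowpass_half)

text \<open>At frequency 0 every factor \<open>alpha\<close> vanishes, and only the packet 0 has none.\<close>

lemma dtswp_hat_at_0: "0 < l \<Longrightarrow> dtswp_hat N p (Suc m) l 0 = 0"
proof (induction m arbitrary: l)
  case (Suc m)
  show ?case
  proof (cases "l div 2 = 0")
    case True
    with Suc.prems have "l = 1" by linarith
    then show ?thesis by (simp add: Let_def alpha_0)
  next
    case False
    then show ?thesis using Suc.IH[of "l div 2"] by (simp add: Let_def)
  qed
qed (simp add: alpha_0)

text \<open>At \<open>N/2\<close> the first factor must be \<open>alpha\<close>, while all later factors are evaluated at a multiple of \<open>N\<close>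
  and must be \<open>beta\<close>. Starting from index 1, each choice of \<open>beta\<close> after an odd index \<open>a\<close> leads to
  \<open>2 a + 1\<close>, so the only survivor is the last packet.\<close>

lemma dtswp_hat_at_half: "l < 2 ^ Suc m - 1 \<Longrightarrow> dtswp_hat N p (Suc m) l (int N div 2) = 0"
proof (induction m arbitrary: l)
  case 0
  then show ?case by (simp add: beta_eq_lowpass lowpass_half)
next
  case (Suc m)
  show ?case
  proof (cases "l div 2 < 2 ^ Suc m - 1")
    case True
    then show ?thesis using Suc.IH by (simp add: Let_def)
  next
    case False
    \<comment> \<open>the parent is the last packet, whose index is odd, so its even child is the one filtered by \<open>alpha\<close>\<close>
    then have l: "l = 2 * (2 ^ Suc m - 1)" using Suc.prems by simp
    have e: "2 ^ Suc m * (int N div 2) = 0 + int N * 2 ^ m"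
      using two_half by simp
    have "filt 1 (2 ^ Suc m * (int N div 2)) = filt 1 0"
      unfolding e by (rule periodic_add_mult) (rule filt_periodic)
    also have "filt 1 0 = 0" using alpha_0 by simp
    finally have "filt 1 (2 ^ Suc m * (int N div 2)) = 0" .
    moreover have "l div 2 = 2 ^ Suc m - 1" "l mod 2 = 0" using l by simp_all
    ultimately show ?thesis
      unfolding dtswp_hat.simps(3) Let_def by simp
  qed
qed

section \<open>Complementary wavelet packets\<close>

text \<open>The multiplier of a discrete Hilbert transform, extended periodically, except that the frequencies
  \<open>0\<close> and \<open>N/2\<close> are kept.\<close>

definition rotation :: "int \<Rightarrow> complex" where
  "rotation n = (let r = n mod int N in
     if r = 0 \<or> 2 * r = int N then 1 else if 2 * r < int N then - \<i> else \<i>)"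

lemma rotation_periodic: "rotation (n + int N) = rotation n"
  by (simp add: rotation_def)

lemma norm_rotation: "cmod (rotation n) = 1"
  by (simp add: rotation_def Let_def)

lemma cnj_rotation: "cnj (rotation n) = rotation (- n)"
proof -
  define r where "r = n mod int N"
  have r: "0 \<le> r" "r < int N" using N by (simp_all add: r_def)
  have "(- n) mod int N = (if r = 0 then 0 else int N - r)"
    by (simp add: r_def zmod_zminus1_eq_if)
  then show ?thesis
    using r by (auto simp: rotation_def Let_def r_def[symmetric])
qed

lemma rotation_odd:
  assumes "n mod int N \<noteq> 0" "2 * (n mod int N) \<noteq> int N"
  shows "rotation (- n) = - rotation n"
  using assms by (simp add: cnj_rotation[symmetric]) (simp add: rotation_def Let_def)

lemma dft_dtswp: "dft N (dtswp N p m l) n = dtswp_hat N p m l n"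
proof -
  obtain x where x: "x \<in> periodic_signals N" "\<And>n. dft N x n = dtswp_hat N p m l n"
    using dft_surj[of N "dtswp_hat N p m l"] N(2) dtswp_hat_periodic cnj_dtswp_hat by metis
  then have "dtswp N p m l = x"
    unfolding dtswp_def by (intro the_equality) (auto intro: dft_inj[OF N(2)])
  then show ?thesis using x by simp
qed

text \<open>The definition of \<open>cwp\<close> prescribes the transform for \<open>- N < 2 n \<le> N\<close>. This range contains one
  representative of every residue class, so it determines the signal.\<close>

lemma cwp_periodic: "cwp N p m l \<in> periodic_signals N" (is ?A)
  and dft_cwp: "dft N (cwp N p m l) n = rotation n * dtswp_hat N p m l n" (is ?B)
proof -
  define X where "X n = rotation n * dtswp_hat N p m l n" for n
  have per: "X (n + int N) = X n" for n
    by (simp add: X_def rotation_periodic dtswp_hat_periodic)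
  have "cnj (X n) = X (- n)" for n
    by (simp add: X_def cnj_rotation cnj_dtswp_hat)
  with per obtain x where x: "x \<in> periodic_signals N" "\<And>n. dft N x n = X n"
    using dft_surj[of N X] N(2) by metis
  let ?P = "\<lambda>x n. (0 < n \<and> 2 * n < int N \<longrightarrow> dft N x n = - \<i> * dft N (dtswp N p m l) n) \<and>
             (- int N < 2 * n \<and> n < 0 \<longrightarrow> dft N x n = \<i> * dft N (dtswp N p m l) n) \<and>
             (n = 0 \<or> 2 * n = int N \<longrightarrow> dft N x n = dft N (dtswp N p m l) n)"
  have r1: "rotation n = - \<i>" if "0 < n" "2 * n < int N" for n
    using that by (simp add: rotation_def)
  have r2: "rotation n = \<i>" if "- int N < 2 * n" "n < 0" for n
  proof -
    have "rotation (- n) = - \<i>" using that by (intro r1) auto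
    then show ?thesis using cnj_rotation[of "- n"] by simp
  qed
  have r3: "rotation n = 1" if "n = 0 \<or> 2 * n = int N" for n
    using that N by (auto simp: rotation_def Let_def)
  have P: "?P x n" for n
    unfolding x dft_dtswp X_def using r1 r2 r3 by simp
  have "y = x" if y: "y \<in> periodic_signals N" and Py: "\<forall>n. ?P y n" for y
  proof (rule dft_inj[OF N(2) y x(1)])
    fix n
    define r where "r = n mod int N"
    \<comment> \<open>the representative of \<open>n\<close> in the prescribed range\<close>
    define k where "k = (if 2 * r \<le> int N then r else r - int N)"
    have r: "0 \<le> r" "r < int N" using N by (simp_all add: r_def)
    have k: "n mod int N = k mod int N" by (simp add: k_def r_def)
    have "- int N < 2 * k" "2 * k \<le> int N" using r by (auto simp: k_def)
    then consider "0 < k \<and> 2 * k < int N" | "- int N < 2 * k \<and> k < 0" | "k = 0 \<or> 2 * k = int N"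
      by linarith
    then have "dft N y k = dft N x k"
    proof cases
      case 1
      show ?thesis using Py[rule_format, of k, THEN conjunct1, rule_format, OF 1]
          P[of k, THEN conjunct1, rule_format, OF 1] by simp
    next
      case 2
      show ?thesis using Py[rule_format, of k, THEN conjunct2, THEN conjunct1, rule_format, OF 2]
          P[of k, THEN conjunct2, THEN conjunct1, rule_format, OF 2] by simp
    next
      case 3
      show ?thesis using Py[rule_format, of k, THEN conjunct2, THEN conjunct2, rule_format, OF 3]
          P[of k, THEN conjunct2, THEN conjunct2, rule_format, OF 3] by simp
    qed
    then show "dft N y n = dft N x n"
      using periodic_cong_mod[of "dft N y" "int N", OF dft_periodic[OF N(2)] k]
        periodic_cong_mod[of "dft N x" "int N", OF dft_periodic[OF N(2)] k] by simp
  qed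
  note uniq = this
  have "cwp N p m l = x"
    unfolding cwp_def
  proof (rule the_equality)
    show "x \<in> periodic_signals N \<and> (\<forall>n. ?P x n)" by (rule conjI[OF x(1) allI[OF P]])
  next
    fix y assume "y \<in> periodic_signals N \<and> (\<forall>n. ?P y n)"
    then show "y = x" using uniq by (elim conjE)
  qed
  then show ?A ?B using x by (simp_all add: X_def)
qed

lemma norm_dft_cwp: "cmod (dft N (cwp N p m l) n) = cmod (dft N (dtswp N p m l) n)"
  by (simp add: dft_cwp dft_dtswp norm_mult norm_rotation)

text \<open>Removing the linear phase from the transform amounts to translating the signal by \<open>C\<close>; what is left
  is odd in the frequency, hence the translated signal is odd in time.\<close>

lemma cwp_antisymmetric:
  assumes "0 < l" "l < 2 ^ Suc m - 1"
  shows "antisymmetric_signal (cwp N p (Suc m) l)"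
proof -
  obtain C R where R: "\<And>n. dtswp_hat N p (Suc m) l n = omega N powi (C * n) * complex_of_real (R n)"
    and R_even: "\<And>n. R (- n) = R n"
    using dtswp_hat_phase by blast
  define T where "T n = rotation n * complex_of_real (R n)" for n
  have T: "T n = omega N powi (- C * n) * (rotation n * dtswp_hat N p (Suc m) l n)" for n
    by (simp add: T_def R power_int_minus)
  have T_per: "T (n + int N) = T n" for n
  proof -
    have "omega N powi (- C * (n + int N)) = omega N powi (- C * n)"
      by (rule omega_powi_cong) (use N in \<open>auto simp: algebra_simps\<close>)
    then show ?thesis unfolding T by (simp add: rotation_periodic dtswp_hat_periodic)
  qed
  have T_odd: "T (- n) = - T n" for n
  proof (cases "n mod int N = 0 \<or> 2 * (n mod int N) = int N")
    case True
    then have "n mod int N = 0 mod int N \<or> n mod int N = (int N div 2) mod int N"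
      using N by auto
    then have "dtswp_hat N p (Suc m) l n = 0"
      using periodic_cong_mod[of "dtswp_hat N p (Suc m) l" "int N" n, OF dtswp_hat_periodic]
        dtswp_hat_at_0[OF assms(1)] dtswp_hat_at_half[OF assms(2)] by metis
    then have "R n = 0" by (simp add: R)
    then show ?thesis by (simp add: T_def R_even)
  next
    case False
    then show ?thesis by (simp add: T_def R_even rotation_odd)
  qed
  have inv: "of_nat N * complex_of_real (cwp N p (Suc m) l (- C + k)) = (\<Sum>n = 0..int N - 1. omega N powi (k * n) * T n)" for k
    unfolding dft_inverse[OF N(2) cwp_periodic] dft_cwp T
  proof (rule sum.cong[OF refl])
    fix n
    have e: "(- C + k) * n = k * n + - C * n" by (simp add: algebra_simps)
    show "omega N powi ((- C + k) * n) * (rotation n * dtswp_hat N p (Suc m) l n)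
        = omega N powi (k * n) * (omega N powi (- C * n) * (rotation n * dtswp_hat N p (Suc m) l n))"
      unfolding e omega_powi_add by (simp only: mult.assoc)
  qed
  have "cwp N p (Suc m) l (- C + k) = - cwp N p (Suc m) l (- C - k)" for k
  proof -
    have "of_nat N * complex_of_real (cwp N p (Suc m) l (- C - k))
        = (\<Sum>n = 0..int N - 1. - (omega N powi (k * - n) * T (- n)))"
      using inv[of "- k"] by (simp add: T_odd)
    also have "\<dots> = (\<Sum>n = 0..int N - 1. - (omega N powi (k * n) * T n))"
      by (rule sum_reflect_periodic[where g = "\<lambda>n. - (omega N powi (k * n) * T n)"])
         (use N in \<open>auto simp: T_per algebra_simps intro!: omega_powi_cong\<close>)
    also have "\<dots> = of_nat N * complex_of_real (- cwp N p (Suc m) l (- C + k))"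
      using inv[of k] by (simp add: sum_negf)
    finally have "complex_of_real (cwp N p (Suc m) l (- C - k)) = complex_of_real (- cwp N p (Suc m) l (- C + k))"
      unfolding mult_cancel_left using N by (simp del: of_real_minus)
    then have "cwp N p (Suc m) l (- C - k) = - cwp N p (Suc m) l (- C + k)"
      unfolding of_real_eq_iff .
    then show ?thesis by linarith
  qed
  then show ?thesis unfolding antisymmetric_signal_def by (intro exI[of _ "- C"] allI)
qed

text \<open>By Parseval's identity the inner product is a sum over all frequencies. Grouping them into
  aliases \<open>k + r L\<close>, on which the exponential \<open>W\<close> from the translations is constant, leaves the constant of
  \<open>dtswp_hat_orthogonal\<close> times a full sum of \<open>L\<close>-th roots of unity, which detects \<open>s = t\<close>.\<close>

lemma cwp_orthonormal:
  assumes NL: "N = 2 ^ Suc m * L" and l: "l < 2 ^ Suc m" "l' < 2 ^ Suc m" and st: "s < L" "t < L"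
  shows "signal_inner N (\<lambda>k. cwp N p (Suc m) l (k - 2 ^ Suc m * int s))
       (\<lambda>k. cwp N p (Suc m) l' (k - 2 ^ Suc m * int t)) = (if l = l' \<and> s = t then 1 else 0)"
proof -
  let ?h = "dtswp_hat N p (Suc m)"
  define q where "q = int t - int s"
  define W where "W n = omega N powi (2 ^ Suc m * q * n)" for n
  define G where "G n = ?h l n * cnj (?h l' n)" for n
  have shift_per: "(\<lambda>k. cwp N p (Suc m) l (k - a)) \<in> periodic_signals N" for l a
  proof -
    have "cwp N p (Suc m) l (k + int N - a) = cwp N p (Suc m) l (k - a)" for k
    proof -
      have "cwp N p (Suc m) l (k - a + int N) = cwp N p (Suc m) l (k - a)"
        using cwp_periodic[of "Suc m" l] by (simp add: periodic_signals_def)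
      then show ?thesis by (simp add: algebra_simps)
    qed
    then show ?thesis by (simp add: periodic_signals_def)
  qed
  have "of_nat N * complex_of_real (signal_inner N (\<lambda>k. cwp N p (Suc m) l (k - 2 ^ Suc m * int s))
       (\<lambda>k. cwp N p (Suc m) l' (k - 2 ^ Suc m * int t)))
     = (\<Sum>n = 0..int N - 1. W n * G n)"
    unfolding parseval[OF N(2) shift_per] dft_shift[OF N(2) cwp_periodic] dft_cwp
  proof (rule sum.cong[OF refl])
    fix n
    have rot: "rotation n * cnj (rotation n) = 1"
      using norm_rotation[of n] by (simp add: complex_norm_square[symmetric])
    have W: "omega N powi (- (2 ^ Suc m * int s) * n) * cnj (omega N powi (- (2 ^ Suc m * int t) * n)) = W n"
      by (simp add: W_def q_def algebra_simps flip: omega_powi_add)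
    have "omega N powi (- (2 ^ Suc m * int s) * n) * (rotation n * ?h l n)
        * cnj (omega N powi (- (2 ^ Suc m * int t) * n) * (rotation n * ?h l' n))
      = (omega N powi (- (2 ^ Suc m * int s) * n) * cnj (omega N powi (- (2 ^ Suc m * int t) * n)))
        * (rotation n * cnj (rotation n)) * G n"
      unfolding G_def complex_cnj_mult by (simp only: mult_ac)
    then show "omega N powi (- (2 ^ Suc m * int s) * n) * (rotation n * ?h l n)
        * cnj (omega N powi (- (2 ^ Suc m * int t) * n) * (rotation n * ?h l' n)) = W n * G n"
      unfolding rot W by simp
  qed
  also have "\<dots> = (\<Sum>r<2 ^ Suc m. \<Sum>k = r * L..<r * L + L. W (int k) * G (int k))"
    unfolding sum_int_interval_eq_sum_nat NL by (rule sum.nat_group[symmetric])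
  also have "\<dots> = (\<Sum>r<2 ^ Suc m. \<Sum>k<L. W (int k) * G (int k + int r * int L))"
  proof (rule sum.cong[OF refl])
    fix r
    have "W (int k + int r * int L) = W (int k)" for k
      unfolding W_def by (rule omega_powi_cong) (use N NL in \<open>auto simp: algebra_simps\<close>)
    then have "(\<Sum>k<L. W (int k) * G (int k + int r * int L)) = (\<Sum>k = r * L..<r * L + L. W (int k) * G (int k))"
      by (intro sum.reindex_bij_witness[of _ "\<lambda>k. k - r * L" "\<lambda>k. k + r * L"]) auto
    then show "(\<Sum>k = r * L..<r * L + L. W (int k) * G (int k)) = (\<Sum>k<L. W (int k) * G (int k + int r * int L))"
      by (rule sym)
  qed
  also have "\<dots> = (\<Sum>k<L. W (int k) * (\<Sum>r<2 ^ Suc m. G (int k + int r * int L)))"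
    unfolding sum_distrib_left by (rule sum.swap)
  also have "\<dots> = (\<Sum>k<L. W (int k)) * (if l = l' then 2 ^ Suc m else 0)"
    unfolding G_def dtswp_hat_orthogonal[OF NL l] sum_distrib_right ..
  also have "(\<Sum>k<L. W (int k)) = (if s = t then of_nat L else 0)"
  proof -
    have L: "L > 0" using st by simp
    have "W k = omega L powi (k * q)" for k
      unfolding W_def omega_powi using NL L by (simp add: field_simps)
    then have "(\<Sum>k<L. W (int k)) = (if int L dvd q then of_nat L else 0)"
      using sum_omega_powi[OF L, of q] by (simp add: sum_int_interval_eq_sum_nat)
    moreover have "int L dvd q \<longleftrightarrow> s = t"
    proof
      assume "int L dvd q"
      then have "int t mod int L = int s mod int L" by (simp add: q_def mod_eq_dvd_iff)
      then show "s = t" using st by simp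
    qed (simp add: q_def)
    ultimately show ?thesis by simp
  qed
  finally have "of_nat N * complex_of_real (signal_inner N (\<lambda>k. cwp N p (Suc m) l (k - 2 ^ Suc m * int s))
       (\<lambda>k. cwp N p (Suc m) l' (k - 2 ^ Suc m * int t)))
     = of_nat N * complex_of_real (if l = l' \<and> s = t then 1 else 0)"
    by (simp add: NL)
  then have "complex_of_real (signal_inner N (\<lambda>k. cwp N p (Suc m) l (k - 2 ^ Suc m * int s))
       (\<lambda>k. cwp N p (Suc m) l' (k - 2 ^ Suc m * int t))) = complex_of_real (if l = l' \<and> s = t then 1 else 0)"
    using N(2) by simp
  then show ?thesis by (simp only: of_real_eq_iff)
qed

end

theorem proposition3p3:
  fixes N j p M :: nat
  assumes "N = 2 ^ j"
    and "1 \<le> p" and "real p \<le> real N / 2 - 2"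
    and "1 \<le> M" and "2 ^ M < N"
  shows "(\<forall>m\<in>{1..M}. \<forall>l\<in>{0..2 ^ m - 1}. \<forall>n.
            cmod (dft N (cwp N p m l) n) = cmod (dft N (dtswp N p m l) n)) \<and>
         (\<forall>m\<in>{1..M}. \<forall>l\<in>{1..2 ^ m - 2}. antisymmetric_signal (cwp N p m l)) \<and>
         (\<forall>m\<in>{1..M}. \<forall>l\<in>{0..2 ^ m - 1}. \<forall>l'\<in>{0..2 ^ m - 1}.
            \<forall>s\<in>{0..N div 2 ^ m - 1}. \<forall>t\<in>{0..N div 2 ^ m - 1}.
              signal_inner N (\<lambda>k. cwp N p m l (k - 2 ^ m * int s))
                             (\<lambda>k. cwp N p m l' (k - 2 ^ m * int t))
                = (if l = l' \<and> s = t then 1 else 0))"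
proof -
  have "M < j" using assms(1,5) by simp
  then have dvd: "2 ^ m dvd N" if "m \<in> {1..M}" for m
    using that assms(1) by (auto intro: le_imp_power_dvd)
  have "even N" using dvd[of 1] assms(4) by simp
  moreover have "p < N" using assms(3) by linarith
  ultimately interpret spline_filters N p
    using assms(1,2) by unfold_locales auto
  have lt: "l < 2 ^ m" if "l \<in> {0..2 ^ m - 1}" for l m :: nat
  proof -
    have "(0::nat) < 2 ^ m" by simp
    with that show ?thesis unfolding atLeastAtMost_iff by linarith
  qed
  show ?thesis
  proof (intro conjI ballI allI norm_dft_cwp)
    fix m l assume m: "m \<in> {1..M}" and l: "l \<in> {1..2 ^ m - 2 :: nat}"
    obtain k where k: "m = Suc k" using m by (cases m) auto
    show "antisymmetric_signal (cwp N p m l)"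
      using l unfolding k by (intro cwp_antisymmetric) auto
  next
    fix m l l' s t
    assume m: "m \<in> {1..M}" and l: "l \<in> {0..2 ^ m - 1 :: nat}" "l' \<in> {0..2 ^ m - 1 :: nat}"
      and st: "s \<in> {0..N div 2 ^ m - 1}" "t \<in> {0..N div 2 ^ m - 1}"
    obtain k where k: "m = Suc k" using m by (cases m) auto
    have NL: "N = 2 ^ m * (N div 2 ^ m)" using dvd[OF m] by simp
    then have "N div 2 ^ m > 0" using N(2) by (metis gr0I mult_0_right less_irrefl)
    then have "s < N div 2 ^ m" "t < N div 2 ^ m" using st by auto
    with NL lt[OF l(1)] lt[OF l(2)]
    show "signal_inner N (\<lambda>k. cwp N p m l (k - 2 ^ m * int s)) (\<lambda>k. cwp N p m l' (k - 2 ^ m * int t))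
        = (if l = l' \<and> s = t then 1 else 0)"
      unfolding k by (rule cwp_orthonormal)
  qed
qed

end
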